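(* Let $n\ge1$ and let $\mathfrak{se}(n)\subseteq M_{n+1}(\mathbb R)$ be the set of block matrices $\begin{bmatrix}a&v\\0&0\end{bmatrix}$ with $a\in M_n(\mathbb R)$, $a^T=-a$, and $v\in\mathbb R^n$. For every $l_0=\begin{bmatrix}A&w\\ {u}^T&c\end{bmatrix}\in M_{n+1}(\mathbb R)$ with $A\in M_n(\mathbb R)$, $w,u\in\mathbb R^n$, $c\in\mathbb R$, the orthogonal projection of $l_0$ onto $\mathfrak{se}(n)$ acts blockwise (antisymmetrize the upper-left block, retain the translation column, zero the bottom row): $$\mathrm{proj}_{\mathfrak{se}(n)}(l_0)=\begin{bmatrix}\tfrac12(A-A^T)&w\\0&0\end{bmatrix}.$$
   Context: Orthogonality is with respect to the Frobenius inner product $\langle A,B\rangle=\mathrm{tr}(A^TB)$ on $M_{n+1}(\mathbb R)$. The orthogonal projection of $l_0$ onto a subspace $\mathfrak g$ is the element $P\in\mathfrak g$ with $\langle l_0-P,Y\rangle=0$ for all $Y\in\mathfrak g$. $\mathfrak{se}(n)$ is the Lie algebra of the special Euclidean group of matrices $\begin{bmatrix}R&t\\0&1\end{bmatrix}$, $R\in SO(n)$, $t\in\mathbb R^n$. *)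

theory Defs
  imports Complex_Main "Jordan_Normal_Form.Matrix"
begin

definition mat_trace :: "real mat \<Rightarrow> real" where
  "mat_trace M = (\<Sum>i<dim_row M. M $$ (i, i))"

definition frobenius_inner :: "real mat \<Rightarrow> real mat \<Rightarrow> real" where
  "frobenius_inner M N = mat_trace (transpose_mat M * N)"

definition is_orthogonal_projection :: "real mat set \<Rightarrow> real mat \<Rightarrow> real mat \<Rightarrow> bool" where
  "is_orthogonal_projection \<gg> l P \<longleftrightarrow>
     P \<in> \<gg> \<and> (\<forall>Y\<in>\<gg>. frobenius_inner (l - P) Y = 0)"

(* A definite description: it is meaningful only where exactly one P qualifies,
   so a statement about its value should come with a proof of unique existence. *)
definition orthogonal_projection :: "real mat set \<Rightarrow> real mat \<Rightarrow> real mat" where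
  "orthogonal_projection \<gg> l = (THE P. is_orthogonal_projection \<gg> l P)"

definition se_algebra :: "nat \<Rightarrow> real mat set" where
  "se_algebra n =
     {four_block_mat a (mat_of_cols n [v]) (0\<^sub>m 1 n) (0\<^sub>m 1 1) | a v.
        a \<in> carrier_mat n n \<and> transpose_mat a = - a \<and> v \<in> carrier_vec n}"

end

theory Submission
  imports Defs
begin

text \<open>
  The trace form is the Euclidean inner product of the matrix entries, so it is positive definite.
  Hence a linear space of matrices contains at most one orthogonal projection of a given matrix:
  the difference of two candidates lies in the space and is orthogonal to itself. What remains is
  to recognise the claimed block matrix \<open>P\<close> as a projection. For \<open>Y\<close> in the Lie algebra, the
  entrywise product of \<open>l\<^sub>0 - P\<close> and \<open>Y\<close> is antisymmetric: on the upper-left block a symmetric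
  matrix, \<open>(A + A\<^sup>T) / 2\<close>, meets an antisymmetric one; in the last column \<open>l\<^sub>0 - P\<close> vanishes above
  the corner; and in the last row \<open>Y\<close> vanishes. The entries of an antisymmetric array sum to zero.
\<close>

lemma frobenius_inner_eq_sum:
  assumes "M \<in> carrier_mat m k" "N \<in> carrier_mat m k"
  shows "frobenius_inner M N = (\<Sum>j<k. \<Sum>i<m. M $$ (i, j) * N $$ (i, j))"
  using assms
  by (auto simp: frobenius_inner_def mat_trace_def scalar_prod_def lessThan_atLeast0
      intro!: sum.cong)

lemma frobenius_inner_diff_left:
  assumes "M \<in> carrier_mat m k" "M' \<in> carrier_mat m k" "N \<in> carrier_mat m k"
  shows "frobenius_inner (M - M') N = frobenius_inner M N - frobenius_inner M' N"
  using assms frobenius_inner_eq_sum[OF minus_carrier_mat[OF assms(2)] assms(3)]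
  by (simp add: frobenius_inner_eq_sum[of _ m k] left_diff_distrib sum_subtractf)

lemma frobenius_inner_self_eq_0_imp:
  assumes M: "M \<in> carrier_mat m k" and "frobenius_inner M M = 0"
  shows "M = 0\<^sub>m m k"
proof (rule eq_matI)
  have nonneg: "0 \<le> (\<Sum>i<m. M $$ (i, j) * M $$ (i, j))" for j
    by (intro sum_nonneg) auto
  have "(\<Sum>j<k. \<Sum>i<m. M $$ (i, j) * M $$ (i, j)) = 0"
    using assms frobenius_inner_eq_sum[OF M M] by simp
  then have "(\<Sum>i<m. M $$ (i, j) * M $$ (i, j)) = 0" if "j < k" for j
    using that nonneg by (subst (asm) sum_nonneg_eq_0_iff) auto
  then have "M $$ (i, j) * M $$ (i, j) = 0" if "i < m" "j < k" for i j
    using that by (subst (asm) sum_nonneg_eq_0_iff) auto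
  then show "M $$ (i, j) = 0\<^sub>m m k $$ (i, j)"
    if "i < dim_row (0\<^sub>m m k :: real mat)" "j < dim_col (0\<^sub>m m k :: real mat)" for i j
    using that by simp
qed (use M in auto)

text \<open>
  For projections \<open>P\<close> and \<open>Q\<close> of the same matrix \<open>l\<close>, the vector \<open>P - Q\<close> lies in the space,
  hence it is orthogonal to both \<open>l - P\<close> and \<open>l - Q\<close>, and so to their difference \<open>P - Q\<close>.
\<close>

lemma is_orthogonal_projection_unique:
  assumes l: "l \<in> carrier_mat m k" and sub: "\<gg> \<subseteq> carrier_mat m k"
    and diff: "\<And>X Y. X \<in> \<gg> \<Longrightarrow> Y \<in> \<gg> \<Longrightarrow> X - Y \<in> \<gg>"
    and P: "is_orthogonal_projection \<gg> l P" and Q: "is_orthogonal_projection \<gg> l Q"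
  shows "P = Q"
proof -
  have in_\<gg>: "P \<in> \<gg>" "Q \<in> \<gg>" "P - Q \<in> \<gg>"
    using P Q diff by (auto simp: is_orthogonal_projection_def)
  then have carr: "P \<in> carrier_mat m k" "Q \<in> carrier_mat m k" "P - Q \<in> carrier_mat m k"
    using sub by auto
  have "frobenius_inner (l - P) (P - Q) = 0" "frobenius_inner (l - Q) (P - Q) = 0"
    using P Q in_\<gg> by (auto simp: is_orthogonal_projection_def)
  then have "frobenius_inner (P - Q) (P - Q) = 0"
    using l carr by (simp add: frobenius_inner_diff_left[of _ m k])
  then have "P - Q = 0\<^sub>m m k"
    using carr frobenius_inner_self_eq_0_imp by blast
  then have "P $$ (i, j) - Q $$ (i, j) = 0" if "i < m" "j < k" for i j
    using that carr by (metis carrier_matD index_minus_mat(1) index_zero_mat(1))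
  then show ?thesis
    using carr by (intro eq_matI) auto
qed

lemma sum_antisymmetric_eq_0:
  fixes f :: "'a \<Rightarrow> 'a \<Rightarrow> real"
  assumes "\<And>i j. i \<in> S \<Longrightarrow> j \<in> S \<Longrightarrow> f i j = - f j i"
  shows "(\<Sum>j\<in>S. \<Sum>i\<in>S. f i j) = 0"
proof -
  have "(\<Sum>j\<in>S. \<Sum>i\<in>S. f i j) = (\<Sum>j\<in>S. \<Sum>i\<in>S. - f j i)"
    by (intro sum.cong refl assms)
  also have "\<dots> = - (\<Sum>j\<in>S. \<Sum>i\<in>S. f i j)"
    by (subst sum.swap) (simp add: sum_negf)
  finally show ?thesis
    by simp
qed

text \<open>
  The entrywise description turns closure under subtraction, and membership of the projected
  matrix, into statements about real numbers.
\<close>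

lemma se_algebra_iff:
  "M \<in> se_algebra n \<longleftrightarrow> M \<in> carrier_mat (Suc n) (Suc n) \<and>
     (\<forall>i<n. \<forall>j<n. M $$ (i, j) = - M $$ (j, i)) \<and> (\<forall>j\<le>n. M $$ (n, j) = 0)"
    (is "_ \<longleftrightarrow> ?entries")
proof
  assume "M \<in> se_algebra n"
  then obtain a v where
    M: "M = four_block_mat a (mat_of_cols n [v]) (0\<^sub>m 1 n) (0\<^sub>m 1 1)"
    and a: "a \<in> carrier_mat n n" "transpose_mat a = - a" and v: "v \<in> carrier_vec n"
    unfolding se_algebra_def by blast
  have anti: "a $$ (i, j) = - a $$ (j, i)" if "i < n" "j < n" for i j
    using that a by (metis carrier_matD index_transpose_mat(1) index_uminus_mat(1))
  have "M $$ (i, j) = - M $$ (j, i)" if "i < n" "j < n" for i j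
    using that a(1) anti[of i j] by (simp add: M)
  moreover have "M \<in> carrier_mat (Suc n) (Suc n)" "\<forall>j\<le>n. M $$ (n, j) = 0"
    using a(1) by (auto simp: M)
  ultimately show ?entries
    by blast
next
  assume entries: ?entries
  then have M: "M \<in> carrier_mat (Suc n) (Suc n)"
    and anti: "\<And>i j. i < n \<Longrightarrow> j < n \<Longrightarrow> - M $$ (j, i) = M $$ (i, j)"
    and row: "\<And>j. j \<le> n \<Longrightarrow> M $$ (n, j) = 0"
    by metis+
  define a where "a = mat n n (\<lambda>ij. M $$ ij)"
  define v where "v = vec n (\<lambda>i. M $$ (i, n))"
  have "transpose_mat a = - a"
  proof (rule eq_matI)
    show "transpose_mat a $$ (i, j) = (- a) $$ (i, j)"
      if "i < dim_row (- a)" "j < dim_col (- a)" for i j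
      using that anti[of j i] by (simp add: a_def)
  qed (simp_all add: a_def)
  moreover have "M = four_block_mat a (mat_of_cols n [v]) (0\<^sub>m 1 n) (0\<^sub>m 1 1)"
    using M row by (intro eq_matI) (auto simp: a_def v_def mat_of_cols_def less_Suc_eq)
  moreover have "a \<in> carrier_mat n n" "v \<in> carrier_vec n"
    by (auto simp: a_def v_def)
  ultimately show "M \<in> se_algebra n"
    unfolding se_algebra_def by blast
qed

lemma se_algebra_diff:
  assumes "X \<in> se_algebra n" "Y \<in> se_algebra n"
  shows "X - Y \<in> se_algebra n"
proof -
  have carr: "X \<in> carrier_mat (Suc n) (Suc n)" "Y \<in> carrier_mat (Suc n) (Suc n)"
    and row: "\<And>j. j \<le> n \<Longrightarrow> X $$ (n, j) = 0" "\<And>j. j \<le> n \<Longrightarrow> Y $$ (n, j) = 0"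
    using assms unfolding se_algebra_iff by blast+
  have "(X - Y) $$ (i, j) = - (X - Y) $$ (j, i)" if "i < n" "j < n" for i j
  proof -
    have "X $$ (i, j) = - X $$ (j, i)" "Y $$ (i, j) = - Y $$ (j, i)"
      using assms that unfolding se_algebra_iff by blast+
    then show ?thesis
      using that carr by simp
  qed
  moreover have "X - Y \<in> carrier_mat (Suc n) (Suc n)" "\<forall>j\<le>n. (X - Y) $$ (n, j) = 0"
    using carr row by auto
  ultimately show ?thesis
    unfolding se_algebra_iff by blast
qed

theorem mainTheorem8:
  fixes n :: nat and l\<^sub>0 A :: "real mat" and w u :: "real vec" and c :: real
  assumes "n \<ge> 1"
    and "A \<in> carrier_mat n n" and "w \<in> carrier_vec n" and "u \<in> carrier_vec n"
    and "l\<^sub>0 = four_block_mat A (mat_of_cols n [w]) (mat_of_rows n [u]) (mat 1 1 (\<lambda>_. c))"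
  shows "(\<exists>!P. is_orthogonal_projection (se_algebra n) l\<^sub>0 P) \<and>
    orthogonal_projection (se_algebra n) l\<^sub>0 =
      four_block_mat ((1/2) \<cdot>\<^sub>m (A - transpose_mat A)) (mat_of_cols n [w]) (0\<^sub>m 1 n) (0\<^sub>m 1 1)"
proof -
  note A = assms(2) and l\<^sub>0_eq = assms(5)
  define P where "P = four_block_mat ((1/2) \<cdot>\<^sub>m (A - transpose_mat A)) (mat_of_cols n [w])
    (0\<^sub>m 1 n) (0\<^sub>m 1 1)"
  have l\<^sub>0: "l\<^sub>0 \<in> carrier_mat (Suc n) (Suc n)"
    using A by (auto simp: l\<^sub>0_eq)
  have P_se: "P \<in> se_algebra n"
    using A by (auto simp: se_algebra_iff P_def field_simps)
  then have P: "P \<in> carrier_mat (Suc n) (Suc n)"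
    unfolding se_algebra_iff by blast
  have D_block: "(l\<^sub>0 - P) $$ (i, j) = (A $$ (i, j) + A $$ (j, i)) / 2" if "i < n" "j < n" for i j
    using that A by (simp add: l\<^sub>0_eq P_def field_simps)
  have D_col: "(l\<^sub>0 - P) $$ (i, n) = 0" if "i < n" for i
    using that A by (simp add: l\<^sub>0_eq P_def)
  have "frobenius_inner (l\<^sub>0 - P) Y = 0" if "Y \<in> se_algebra n" for Y
  proof -
    let ?f = "\<lambda>i j. (l\<^sub>0 - P) $$ (i, j) * Y $$ (i, j)"
    have Y: "Y \<in> carrier_mat (Suc n) (Suc n)"
      and Y_block: "\<And>i j. i < n \<Longrightarrow> j < n \<Longrightarrow> Y $$ (i, j) = - Y $$ (j, i)"
      and Y_row: "\<And>j. j \<le> n \<Longrightarrow> Y $$ (n, j) = 0"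
      using that unfolding se_algebra_iff by blast+
    have border: "?f i n = 0" "?f n i = 0" if "i \<le> n" for i
      using that D_col Y_row by (cases "i = n"; simp)+
    have block: "?f i j = - ?f j i" if "i < n" "j < n" for i j
    proof -
      have "(l\<^sub>0 - P) $$ (i, j) = (l\<^sub>0 - P) $$ (j, i)"
        using D_block[OF that] D_block[OF that(2,1)] by (simp only: add.commute)
      then show ?thesis
        using Y_block[OF that] by (metis mult_minus_right)
    qed
    have "?f i j = - ?f j i" if "i \<in> {..<Suc n}" "j \<in> {..<Suc n}" for i j
    proof (cases "i = n \<or> j = n")
      case True
      then have "?f i j = 0" "?f j i = 0"
        using border that by fastforce+
      then show ?thesis by (simp only: minus_zero)
    next
      case False
      then show ?thesis
        using that by (intro block) auto
    qed
    then have "(\<Sum>j<Suc n. \<Sum>i<Suc n. ?f i j) = 0"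
      by (rule sum_antisymmetric_eq_0)
    then show ?thesis
      using l\<^sub>0 P Y by (subst frobenius_inner_eq_sum[of _ "Suc n" "Suc n"]) auto
  qed
  with P_se have proj: "is_orthogonal_projection (se_algebra n) l\<^sub>0 P"
    by (simp add: is_orthogonal_projection_def)
  have unique: "Q = P" if "is_orthogonal_projection (se_algebra n) l\<^sub>0 Q" for Q
  proof (rule is_orthogonal_projection_unique)
    show "se_algebra n \<subseteq> carrier_mat (Suc n) (Suc n)"
      unfolding se_algebra_iff subset_iff by blast
  qed (fact l\<^sub>0 se_algebra_diff that proj)+
  have "orthogonal_projection (se_algebra n) l\<^sub>0 = P"
    unfolding orthogonal_projection_def using proj unique by (rule the_equality)
  with proj unique show ?thesis
    unfolding P_def by blast
qed

end
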